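(* Let $G$ be a linear algebraic group over a global field $\mathbb K$ of characteristic zero. Let $p$ be a prime number. Let $E$ be a set of elements $g\in G(\mathbb K)$ such that each $g\in E$ has $p^k$-th roots in $G(\mathbb K)$ for all $k\in\mathbb N$ (i.e. for every $k\in\mathbb N$ there is $h\in G(\mathbb K)$ with $h^{p^k}=g$). Then there exists $r\in\mathbb N$, $r\ge 1$, such that for each $g\in E$, $g^r$ is unipotent. In particular, if $P_k(G(\mathbb K))=G(\mathbb K)$ for all $k\in\mathbb N$, then $G(\mathbb K)$ is a unipotent group.
   Context: A global field is a finite extension of either $\mathbb Q$ or $\mathbb F_p(t)$; in characteristic zero it is a finite extension of $\mathbb Q$. $P_k$ denotes the $k$-th power map $g\mapsto g^k$. That $G(\mathbb K)$ is a unipotent group means that all of its elements are unipotent. *)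

theory Defs
  imports
    "HOL-Algebra.Algebraic_Closure_Type"
    "HOL-Library.Poly_Mapping"
    "HOL-Computational_Algebra.Primes"
    "Jordan_Normal_Form.Matrix"
begin

text \<open>A global field of characteristic zero is a finite extension of the rational numbers.\<close>

definition number_field :: "'a::field_char_0 itself \<Rightarrow> bool" where
  "number_field _ \<longleftrightarrow>
     (\<exists>B :: 'a set. finite_dimensional_vector_space (\<lambda>(q :: rat) (x :: 'a). of_rat q * x) B)"

lemma number_field_rat: "number_field TYPE(rat)"
proof -
  interpret vector_space "\<lambda>(q :: rat) (x :: rat). of_rat q * x"
    by unfold_locales (simp_all add: of_rat_add of_rat_mult algebra_simps)
  have "span {1 :: rat} = UNIV"
  proof (intro equalityI subsetI UNIV_I)
    fix x :: rat
    show "x \<in> span {1}"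
      using span_scale[OF span_base[of 1 "{1}"], of x] by simp
  qed
  moreover have "independent {1 :: rat}"
    by (rule independent_insertI, unfold span_empty, simp, rule independent_empty)
  ultimately have "finite_dimensional_vector_space (\<lambda>(q :: rat) (x :: rat). of_rat q * x) {1}"
    by unfold_locales auto
  then show ?thesis
    unfolding number_field_def by blast
qed

text \<open>
  Polynomials in the matrix entries \<open>x\<^sub>i\<^sub>j\<close>, with \<open>i, j < n\<close>: a polynomial maps each monomial
  (itself a finitely supported map from variables to exponents) to its coefficient.
\<close>

type_synonym 'a entry_poly = "((nat \<times> nat) \<Rightarrow>\<^sub>0 nat) \<Rightarrow>\<^sub>0 'a"

definition entry_polys :: "nat \<Rightarrow> 'a::zero entry_poly set" where
  "entry_polys n = {f. \<forall>m \<in> Poly_Mapping.keys f. Poly_Mapping.keys m \<subseteq> {..<n} \<times> {..<n}}"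

definition eval_entry_poly :: "('a::field) entry_poly \<Rightarrow> 'a alg_closure mat \<Rightarrow> 'a alg_closure" where
  "eval_entry_poly f g =
     (\<Sum>m\<in>Poly_Mapping.keys f. to_ac (Poly_Mapping.lookup f m) *
        (\<Prod>v\<in>Poly_Mapping.keys m. (g $$ v) ^ Poly_Mapping.lookup m v))"

definition GL :: "nat \<Rightarrow> 'a::comm_ring_1 mat monoid" where
  "GL n = units_of (ring_mat TYPE('a) n ())"

text \<open>
  A linear algebraic group over a field \<open>K\<close> of characteristic zero, given by its points over an
  algebraic closure of \<open>K\<close>: a subgroup of the general linear group that is the zero locus of
  polynomials with coefficients in \<open>K\<close>. The inverse of the determinant is not needed as a further
  variable, since it can be cleared from the equations.
\<close>

definition linear_algebraic_group :: "nat \<Rightarrow> ('a::field_char_0) alg_closure mat set \<Rightarrow> bool" where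
  "linear_algebraic_group n G \<longleftrightarrow>
     subgroup G (GL n) \<and>
     (\<exists>S \<subseteq> (entry_polys n :: 'a entry_poly set).
        G = {g \<in> carrier (GL n). \<forall>f\<in>S. eval_entry_poly f g = 0})"

text \<open>The group \<open>G(K)\<close> of points with entries in \<open>K\<close>.\<close>

definition rational_points :: "('a::field) alg_closure mat set \<Rightarrow> 'a mat set" where
  "rational_points G = {g. map_mat to_ac g \<in> G}"

definition unipotent :: "'a::comm_ring_1 mat \<Rightarrow> bool" where
  "unipotent g \<longleftrightarrow> square_mat g \<and>
     (\<exists>m. (g - 1\<^sub>m (dim_row g)) ^\<^sub>m m = 0\<^sub>m (dim_row g) (dim_row g))"

text \<open>The power map \<open>P\<^sub>k\<close>.\<close>

definition power_map :: "nat \<Rightarrow> 'a::semiring_1 mat \<Rightarrow> 'a mat" where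
  "power_map k g = g ^\<^sub>m k"

end

theory Submission
  imports Defs "Berlekamp_Zassenhaus.Factor_Bound" "HOL-Library.Function_Algebras"
begin

text \<open>
  Every \<open>n \<times> n\<close> matrix over \<open>K\<close> lies in a \<open>\<rat>\<close>-algebra of dimension \<open>N = n\<^sup>2 [K : \<rat>]\<close>, so it has a
  minimal polynomial over \<open>\<rat>\<close> of degree at most \<open>N\<close>. Working with these rational polynomials
  instead of eigenvalues over \<open>K\<close> turns the theorem into a statement about divisors of bounded
  degree in \<open>\<rat>[x]\<close>.

  If \<open>h\<^sup>m = g\<close> and \<open>f\<close> is the minimal polynomial of \<open>g\<close>, then \<open>f(x\<^sup>m)\<close> annihilates \<open>h\<close>, so the minimal
  polynomial of \<open>h\<close> divides \<open>f(x\<^sup>m)\<close>. The key fact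
  (\<open>finite_divisors_of_power_substitutions\<close>) is that for fixed \<open>f\<close> and \<open>N\<close> only finitely many monic
  polynomials of degree at most \<open>N\<close> divide some \<open>f(x\<^sup>m)\<close>, \<open>m \<ge> 1\<close>: by Gauss's lemma their
  denominators are bounded independently of \<open>m\<close>, and their complex roots, being \<open>m\<close>-th roots of roots
  of \<open>f\<close>, are bounded as well. It plays the part of Northcott's finiteness theorem for heights.

  Suppose that \<open>g\<close> is invertible and has \<open>m\<close>-th roots for infinitely many \<open>m\<close>. By the pigeonhole
  principle a single polynomial \<open>q\<close> is the minimal polynomial of an \<open>m\<close>-th root of \<open>g\<close> for infinitely
  many \<open>m\<close>. For a complex root \<open>z\<close> of \<open>q\<close>, the powers \<open>z\<^sup>m\<close> all lie among the finitely many roots of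
  \<open>f\<close>, none of which is \<open>0\<close>; so two of them coincide and \<open>z\<close> is a root of unity. Hence \<open>q\<close>, and with
  it \<open>f\<close>, divides a power of \<open>x\<^sup>s - 1\<close> for some \<open>s\<close>.

  It remains to make \<open>s\<close> independent of \<open>g\<close>. Monic polynomials of degree at most \<open>N\<close> all of whose
  roots are roots of unity divide \<open>(x\<^sup>s - 1)\<^sup>N\<close> for some \<open>s\<close>, and this is \<open>(x - 1)\<^sup>N\<close> with \<open>x\<^sup>s\<close> put in
  place of \<open>x\<close>. The same finiteness result shows that there are only finitely many of them, so all
  their roots satisfy \<open>z\<^sup>r = 1\<close> for one \<open>r \<ge> 1\<close>. Then \<open>f\<close> divides \<open>(x\<^sup>r - 1)\<^sup>N\<close>, that is,
  \<open>(g\<^sup>r - 1)\<^sup>N = 0\<close>. If every element of \<open>G(K)\<close> has roots of all orders, then \<open>g = h\<^sup>r\<close> for an \<open>h\<close> to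
  which this applies, so \<open>g\<close> itself is unipotent.
\<close>

section \<open>Finitely many divisors of power substitutions\<close>

abbreviation cpoly :: "rat poly \<Rightarrow> complex poly" where
  "cpoly \<equiv> map_poly of_rat"

interpretation cpoly_hom: map_poly_idom_hom "of_rat :: rat \<Rightarrow> complex" ..

text \<open>
  By Gauss's lemma the primitive integer multiple of \<open>q\<close> divides \<open>F\<close> over \<open>\<int>\<close>; its leading coefficient,
  which is a common denominator of \<open>q\<close>, therefore divides that of \<open>F\<close>.
\<close>

lemma monic_divisor_integral:
  fixes q s :: "rat poly" and F :: "int poly"
  assumes "map_poly of_int F = q * s" and monic: "monic q"
  shows "of_int (lead_coeff F) * coeff q i \<in> \<int>"
proof -
  obtain r Q where rQ: "rat_to_normalized_int_poly q = (r, Q)"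
    by (cases "rat_to_normalized_int_poly q")
  from rat_to_int_factor_explicit[OF assms(1) rQ] obtain t where t: "F = Q * t"
    by blast
  note q = rat_to_normalized_int_poly[OF rQ]
  have "r * of_int (lead_coeff Q) = 1"
    using monic q(4) unfolding q(1) by simp
  moreover have "lead_coeff F = lead_coeff Q * lead_coeff t"
    unfolding t by (simp add: lead_coeff_mult)
  ultimately have "of_int (lead_coeff F) * r = of_int (lead_coeff t)"
    by (simp add: mult_ac)
  then have "of_int (lead_coeff F) * coeff q i = of_int (lead_coeff t * coeff Q i)"
    by (subst q(1)) (simp add: mult.assoc[symmetric])
  then show ?thesis by simp
qed

lemma finite_bounded_denominator:
  fixes c :: int and B :: real
  assumes "c \<noteq> 0"
  shows "finite {x :: rat. of_int c * x \<in> \<int> \<and> \<bar>of_rat x\<bar> \<le> B}"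
proof (rule finite_subset)
  let ?M = "\<lceil>\<bar>of_int c\<bar> * B\<rceil>"
  show "{x :: rat. of_int c * x \<in> \<int> \<and> \<bar>of_rat x\<bar> \<le> B} \<subseteq> (\<lambda>z. of_int z / of_int c) ` {- ?M .. ?M}"
  proof
    fix x :: rat
    assume "x \<in> {x :: rat. of_int c * x \<in> \<int> \<and> \<bar>of_rat x\<bar> \<le> B}"
    then obtain z where z: "of_int c * x = of_int z" and B: "\<bar>of_rat x\<bar> \<le> B"
      by (auto elim: Ints_cases)
    have "\<bar>of_int z\<bar> = \<bar>of_int c\<bar> * \<bar>of_rat x :: real\<bar>"
      by (metis abs_mult of_rat_mult of_rat_of_int_eq z)
    also have "\<dots> \<le> \<bar>of_int c\<bar> * B"
      using B by (rule mult_left_mono) simp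
    finally have "z \<in> {- ?M .. ?M}"
      by (auto simp: abs_le_iff) linarith+
    moreover have "x = of_int z / of_int c"
      using z assms by (simp add: field_simps)
    ultimately show "x \<in> (\<lambda>z. of_int z / of_int c) ` {- ?M .. ?M}"
      by blast
  qed
qed simp

lemma finite_polys_with_coeffs_in:
  assumes "finite V"
  shows "finite {p :: 'a::zero poly. degree p \<le> N \<and> (\<forall>i. coeff p i \<in> V)}"
proof (rule finite_subset)
  show "{p :: 'a poly. degree p \<le> N \<and> (\<forall>i. coeff p i \<in> V)}
      \<subseteq> Poly ` {xs. set xs \<subseteq> V \<and> length xs = Suc N}"
  proof
    fix p :: "'a poly"
    assume p: "p \<in> {p. degree p \<le> N \<and> (\<forall>i. coeff p i \<in> V)}"
    have "p = Poly (map (coeff p) [0..<Suc N])"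
      using p by (intro poly_eqI) (auto simp: coeff_Poly_eq nth_default_def coeff_eq_0 simp del: upt_Suc)
    with p show "p \<in> Poly ` {xs. set xs \<subseteq> V \<and> length xs = Suc N}"
      by (intro image_eqI[of _ _ "map (coeff p) [0..<Suc N]"]) auto
  qed
qed (use assms in \<open>simp add: finite_lists_length_eq\<close>)

lemma norm_coeff_prod_linear_le:
  fixes zs :: "complex list"
  assumes "\<And>z. z \<in> set zs \<Longrightarrow> cmod z \<le> R" and "R \<ge> 0"
  shows "cmod (coeff (\<Prod>z\<leftarrow>zs. [:- z, 1:]) i) \<le> (1 + R) ^ length zs"
  using assms(1)
proof (induction zs arbitrary: i)
  case Nil
  then show ?case by (simp add: coeff_1)
next
  case (Cons z zs)
  let ?p = "\<Prod>z\<leftarrow>zs. [:- z, 1:]"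
  have IH: "cmod (coeff ?p j) \<le> (1 + R) ^ length zs" for j
    using Cons by simp
  have z: "cmod z * cmod (coeff ?p i) \<le> R * (1 + R) ^ length zs"
    using Cons.prems IH assms(2) by (intro mult_mono) auto
  have "cmod (coeff (\<Prod>z\<leftarrow>z # zs. [:- z, 1:]) i)
      = cmod (coeff (pCons 0 ?p) i - z * coeff ?p i)"
    by (simp add: algebra_simps)
  also have "\<dots> \<le> cmod (coeff (pCons 0 ?p) i) + cmod z * cmod (coeff ?p i)"
    by (metis norm_mult norm_triangle_ineq4)
  also have "\<dots> \<le> (1 + R) ^ length zs + R * (1 + R) ^ length zs"
  proof (intro add_mono z)
    show "cmod (coeff (pCons 0 ?p) i) \<le> (1 + R) ^ length zs"
      using IH assms(2) by (cases i) auto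
  qed
  finally show ?case by (simp add: algebra_simps)
qed

lemma abs_coeff_le_of_roots_le:
  fixes q :: "rat poly"
  assumes monic: "monic q"
    and roots: "\<And>z. poly (cpoly q) z = 0 \<Longrightarrow> cmod z \<le> R" and "R \<ge> 0"
  shows "\<bar>of_rat (coeff q i)\<bar> \<le> (1 + R) ^ degree q"
proof -
  obtain zs where zs: "smult (lead_coeff (cpoly q)) (\<Prod>z\<leftarrow>zs. [:- z, 1:]) = cpoly q"
      "length zs = degree (cpoly q)"
    using fundamental_theorem_algebra_factorized by blast
  then have split: "cpoly q = (\<Prod>z\<leftarrow>zs. [:- z, 1:])" and len: "length zs = degree q"
    using monic by simp_all
  have "cmod z \<le> R" if "z \<in> set zs" for z
    using that by (intro roots) (auto simp: split poly_prod_list prod_list_zero_iff)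
  then have "cmod (coeff (cpoly q) i) \<le> (1 + R) ^ degree q"
    unfolding split len[symmetric] using assms(3) by (rule norm_coeff_prod_linear_le)
  moreover have "cmod (of_rat x) = \<bar>of_rat x\<bar>" for x
    by (cases x) (simp add: of_rat_rat norm_divide)
  ultimately show ?thesis by simp
qed

lemma cpoly_root_of_dvd_power_substitution:
  assumes "q dvd f \<circ>\<^sub>p monom 1 m" and "poly (cpoly q) z = 0"
  shows "poly (cpoly f) (z ^ m) = 0"
proof -
  obtain s where s: "f \<circ>\<^sub>p monom 1 m = q * s"
    using assms(1) by blast
  have "poly (cpoly f) (z ^ m) = poly (cpoly (f \<circ>\<^sub>p monom 1 m)) z"
    by (simp add: of_rat_hom.map_poly_pcompose poly_pcompose poly_monom of_rat_hom.map_poly_hom_monom)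
  also have "\<dots> = 0"
    unfolding s using assms(2) by (simp add: hom_distribs)
  finally show ?thesis .
qed

text \<open>
  The coefficients of these divisors have bounded denominators and bounded absolute values, with
  bounds independent of \<open>m\<close>: clearing the denominators of \<open>f\<close> also clears those of \<open>f(x\<^sup>m)\<close>, with the
  same leading coefficient, which controls the denominators of a divisor; and if \<open>R \<ge> 1\<close> bounds the
  roots of \<open>f\<close>, then \<open>\<bar>z\<bar>\<^sup>m \<le> R\<close>, hence \<open>\<bar>z\<bar> \<le> R\<close>, for every root \<open>z\<close> of a divisor.
\<close>

lemma finite_divisors_of_power_substitutions:
  fixes f :: "rat poly"
  assumes "f \<noteq> 0"
  shows "finite {q. monic q \<and> degree q \<le> N \<and> (\<exists>m\<ge>1. q dvd f \<circ>\<^sub>p monom 1 m)}"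
    (is "finite ?D")
proof -
  obtain d F where dF: "rat_to_int_poly f = (d, F)"
    by (cases "rat_to_int_poly f")
  note f = rat_to_int_poly[OF dF]
  from f assms have F0: "lead_coeff F \<noteq> 0" by auto
  have "finite (cmod ` {z. poly (cpoly f) z = 0})"
    using assms by (intro finite_imageI poly_roots_finite) simp
  obtain R where R: "R \<ge> 1" "\<And>z. poly (cpoly f) z = 0 \<Longrightarrow> cmod z \<le> R"
  proof
    fix z assume "poly (cpoly f) z = 0"
    with \<open>finite (cmod ` _)\<close> show "cmod z \<le> max 1 (Max (cmod ` {z. poly (cpoly f) z = 0}))"
      by (intro max.coboundedI2 Max_ge) auto
  qed simp
  define V where "V = {x :: rat. of_int (lead_coeff F) * x \<in> \<int> \<and> \<bar>of_rat x\<bar> \<le> (1 + R) ^ N}"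
  have "coeff q i \<in> V" if q: "monic q" "degree q \<le> N"
      and m: "m \<ge> 1" "q dvd f \<circ>\<^sub>p monom 1 m" for q m i
  proof -
    obtain s where s: "f \<circ>\<^sub>p monom 1 m = q * s"
      using m(2) by blast
    have "map_poly of_int (F \<circ>\<^sub>p monom 1 m) = q * smult (of_int d) s"
      using f by (simp add: of_int_hom.map_poly_pcompose of_int_hom.map_poly_hom_monom
          mult_smult_right s[symmetric] pcompose_smult[symmetric])
    from monic_divisor_integral[OF this q(1)]
    have int: "of_int (lead_coeff F) * coeff q i \<in> \<int>"
      using m(1) by (simp add: degree_monom_eq mult.commute[of _ m] coeff_pcompose_x_pow_n)
    have "cmod z \<le> R" if "poly (cpoly q) z = 0" for z
    proof (cases "cmod z \<le> 1")
      case False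
      then have "cmod z \<le> cmod z ^ m"
        using m(1) by (intro self_le_power) auto
      also have "\<dots> \<le> R"
        using R(2)[OF cpoly_root_of_dvd_power_substitution[OF m(2) that]] by (simp add: norm_power)
      finally show ?thesis .
    qed (use R(1) in linarith)
    then have "\<bar>of_rat (coeff q i)\<bar> \<le> (1 + R) ^ degree q"
      using R(1) by (intro abs_coeff_le_of_roots_le q(1)) auto
    also have "\<dots> \<le> (1 + R) ^ N"
      using q(2) R(1) by (intro power_increasing) auto
    finally show ?thesis using int by (simp add: V_def)
  qed
  then have "?D \<subseteq> {q. degree q \<le> N \<and> (\<forall>i. coeff q i \<in> V)}"
    by auto
  moreover have "finite V"
    unfolding V_def using F0 by (rule finite_bounded_denominator)
  ultimately show ?thesis
    using finite_polys_with_coeffs_in finite_subset by blast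
qed

section \<open>Polynomials whose roots are roots of unity\<close>

lemma finite_roots_of_unity_common_exponent:
  fixes Z :: "'a::comm_monoid_mult set"
  assumes "finite Z" and "\<And>z. z \<in> Z \<Longrightarrow> \<exists>s\<ge>1::nat. z ^ s = 1"
  shows "\<exists>r\<ge>1::nat. \<forall>z\<in>Z. z ^ r = 1"
  using assms
proof (induction Z)
  case (insert x Z)
  obtain r s :: nat where "r \<ge> 1" "\<forall>z\<in>Z. z ^ r = 1" "s \<ge> 1" "x ^ s = 1"
    using insert by (meson insertCI)
  then have "\<forall>z\<in>insert x Z. z ^ (r * s) = 1"
    by (metis insertE mult.commute power_mult power_one)
  with \<open>r \<ge> 1\<close> \<open>s \<ge> 1\<close> show ?case
    by (intro exI[of _ "r * s"]) simp
qed auto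

lemma dvd_power_of_roots_of_unity:
  fixes q :: "rat poly"
  assumes monic: "monic q" and deg: "degree q \<le> N"
    and roots: "\<And>z. poly (cpoly q) z = 0 \<Longrightarrow> z ^ s = 1"
  shows "q dvd (monom 1 s - 1) ^ N"
proof -
  obtain zs where zs: "smult (lead_coeff (cpoly q)) (\<Prod>z\<leftarrow>zs. [:- z, 1:]) = cpoly q"
      "length zs = degree (cpoly q)"
    using fundamental_theorem_algebra_factorized by blast
  then have split: "cpoly q = (\<Prod>z\<leftarrow>zs. [:- z, 1:])" and len: "length zs = degree q"
    using monic by simp_all
  have "z ^ s = 1" if "z \<in> set zs" for z
    using that by (intro roots) (auto simp: split poly_prod_list prod_list_zero_iff)
  then have "(\<Prod>z\<leftarrow>zs. [:- z, 1:]) dvd (monom 1 s - 1) ^ length zs"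
  proof (induction zs)
    case (Cons z zs)
    have "[:- z, 1:] dvd monom 1 s - 1"
      using Cons.prems by (simp add: poly_eq_0_iff_dvd[symmetric] poly_monom del: pCons_one)
    with Cons show ?case
      unfolding list.map prod_list.Cons length_Cons power_Suc
      by (intro mult_dvd_mono) auto
  qed simp
  also have "\<dots> dvd (monom 1 s - 1) ^ N"
    using deg len by (intro le_imp_power_dvd) simp
  also have "\<dots> = cpoly ((monom 1 s - 1) ^ N)"
    by (simp add: hom_distribs of_rat_hom.map_poly_hom_monom)
  finally show ?thesis
    unfolding split[symmetric] by (rule of_rat_hom.dvd_map_poly_hom_imp_dvd)
qed

lemma pcompose_monom_minus_1_power:
  "((monom 1 s - 1) ^ e) \<circ>\<^sub>p monom 1 m = (monom 1 (s * m) - 1 :: rat poly) ^ e"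
proof -
  have "monom 1 s \<circ>\<^sub>p monom 1 m = (monom 1 (s * m) :: rat poly)"
    by (simp add: monom_altdef[of _ s] pcompose_smult pcompose_hom.hom_power monom_power mult.commute)
  then show ?thesis
    by (simp add: pcompose_hom.hom_power pcompose_diff pcompose_1)
qed

text \<open>
  By \<open>finite_divisors_of_power_substitutions\<close>, applied to \<open>(x - 1)\<^sup>N\<close>, only finitely many \<open>q\<close> occur, so
  their roots form a finite set of roots of unity.
\<close>

lemma uniform_exponent_of_roots_of_unity:
  "\<exists>r\<ge>1. \<forall>q :: rat poly. monic q \<longrightarrow> degree q \<le> N \<longrightarrow>
     (\<exists>s\<ge>1. \<exists>e. q dvd (monom 1 s - 1) ^ e) \<longrightarrow> q dvd (monom 1 r - 1) ^ N"
proof -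
  define U where "U = {q :: rat poly. monic q \<and> degree q \<le> N \<and>
     (\<exists>s\<ge>1. \<exists>e. q dvd (monom 1 s - 1) ^ e)}"
  define Z where "Z = (\<Union>q\<in>U. {z. poly (cpoly q) z = 0})"
  have root: "z ^ s = 1" if "q dvd (monom 1 s - 1) ^ e" "poly (cpoly q) z = 0" for q s e z
  proof -
    from that(1) obtain t where t: "(monom 1 s - 1) ^ e = q * t"
      by blast
    have "poly (cpoly ((monom 1 s - 1) ^ e)) z = 0"
      unfolding t using that(2) by (simp add: hom_distribs)
    then show ?thesis
      by (simp add: hom_distribs of_rat_hom.map_poly_hom_monom poly_monom split: if_splits)
  qed
  \<comment> \<open>The arbitrary exponent \<open>e\<close> can be lowered to \<open>N\<close>, since a root of \<open>q\<close> has multiplicity at most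
    \<open>degree q\<close>.\<close>
  have "U \<subseteq> {q. monic q \<and> degree q \<le> N \<and> (\<exists>m\<ge>1. q dvd (monom 1 1 - 1) ^ N \<circ>\<^sub>p monom 1 m)}"
    using dvd_power_of_roots_of_unity root unfolding U_def pcompose_monom_minus_1_power by simp blast
  moreover have "(monom 1 1 - 1 :: rat poly) ^ N \<noteq> 0"
  proof -
    have "coeff (monom 1 1 - 1 :: rat poly) 1 \<noteq> 0"
      by simp
    then have "monom 1 1 - 1 \<noteq> (0 :: rat poly)"
      by (metis coeff_0)
    then show ?thesis by simp
  qed
  ultimately have "finite U"
    using finite_divisors_of_power_substitutions finite_subset by blast
  then have "finite Z"
    unfolding Z_def by (intro finite_UN_I poly_roots_finite) (auto simp: U_def)
  moreover have "\<exists>s\<ge>1. z ^ s = 1" if "z \<in> Z" for z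
    using that root unfolding Z_def U_def by blast
  ultimately obtain r where "r \<ge> 1" "\<forall>z\<in>Z. z ^ r = 1"
    using finite_roots_of_unity_common_exponent by blast
  then have "q dvd (monom 1 r - 1) ^ N" if "q \<in> U" for q
    using that unfolding Z_def by (intro dvd_power_of_roots_of_unity) (auto simp: U_def)
  with \<open>r \<ge> 1\<close> show ?thesis
    unfolding U_def by blast
qed

text \<open>
  For a root \<open>z\<close> of \<open>q\<close>, infinitely many powers of \<open>z\<close> lie in the finite set of roots of \<open>f\<close>, so two of
  them are equal; as \<open>0\<close> is not a root of \<open>f\<close>, cancelling makes \<open>z\<close> a root of unity.
\<close>

lemma roots_of_unity_of_infinitely_many_power_substitutions:
  fixes f q :: "rat poly"
  assumes monic: "monic q" and f: "poly f 0 \<noteq> 0"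
    and inf: "infinite {m. q dvd f \<circ>\<^sub>p monom 1 m}"
  shows "\<exists>s\<ge>1. q dvd (monom 1 s - 1) ^ degree q"
proof -
  have "\<exists>s\<ge>1. z ^ s = 1" if z: "poly (cpoly q) z = 0" for z
  proof -
    let ?M = "{m. q dvd f \<circ>\<^sub>p monom 1 m}"
    have "(\<lambda>m. z ^ m) ` ?M \<subseteq> {w. poly (cpoly f) w = 0}"
      using cpoly_root_of_dvd_power_substitution z by blast
    moreover have "finite {w. poly (cpoly f) w = 0}"
      using f by (intro poly_roots_finite) auto
    ultimately have "\<not> inj_on (\<lambda>m. z ^ m) ?M"
      using inf finite_subset finite_imageD by blast
    then obtain k l where kl: "k \<in> ?M" "k < l" "z ^ k = z ^ l"
      unfolding inj_on_def by (metis linorder_neqE_nat)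
    have "z ^ k \<noteq> 0"
    proof
      assume "z ^ k = 0"
      with cpoly_root_of_dvd_power_substitution[OF _ z, of f k] kl(1)
      have "poly (cpoly f) 0 = 0" by simp
      with f show False
        by (simp add: poly_0_coeff_0)
    qed
    moreover have "z ^ k * z ^ (l - k) = z ^ k * 1"
      unfolding power_add[symmetric] using kl(2,3) by simp
    ultimately have "z ^ (l - k) = 1"
      using mult_left_cancel by blast
    moreover have "l - k \<ge> 1"
      using kl(2) by simp
    ultimately show ?thesis by blast
  qed
  moreover have "finite {z. poly (cpoly q) z = 0}"
    using monic by (intro poly_roots_finite) auto
  ultimately obtain s where "s \<ge> 1" "\<forall>z\<in>{z. poly (cpoly q) z = 0}. z ^ s = 1"
    using finite_roots_of_unity_common_exponent[of "{z. poly (cpoly q) z = 0}"] by auto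
  then have "q dvd (monom 1 s - 1) ^ degree q"
    by (intro dvd_power_of_roots_of_unity monic) auto
  with \<open>s \<ge> 1\<close> show ?thesis by blast
qed

section \<open>Rational polynomials evaluated at matrices\<close>

definition mat_poly :: "rat poly \<Rightarrow> 'a::field_char_0 mat \<Rightarrow> 'a mat" where
  "mat_poly p A = fold_coeffs (\<lambda>a M. of_rat a \<cdot>\<^sub>m 1\<^sub>m (dim_row A) + A * M) p
     (0\<^sub>m (dim_row A) (dim_row A))"

context
  fixes n :: nat and A :: "'a::field_char_0 mat"
  assumes A: "A \<in> carrier_mat n n"
begin

lemma mat_poly_0: "mat_poly 0 A = 0\<^sub>m n n"
  using A by (simp add: mat_poly_def)

lemma mat_poly_pCons:
  "mat_poly (pCons a p) A = of_rat a \<cdot>\<^sub>m 1\<^sub>m n + A * mat_poly p A"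
proof (cases "a = 0 \<and> p = 0")
  case True
  with A show ?thesis by (auto simp: mat_poly_0)
next
  case False
  with A show ?thesis by (auto simp: mat_poly_def)
qed

lemma mat_poly_carrier [simp]: "mat_poly p A \<in> carrier_mat n n"
  using A by (induction p) (auto simp: mat_poly_0 mat_poly_pCons)

lemmas mat_poly_dim [simp] = carrier_matD[OF mat_poly_carrier]

lemma mat_poly_1: "mat_poly 1 A = 1\<^sub>m n"
  using A by (simp add: one_pCons mat_poly_pCons mat_poly_0 del: pCons_one) auto

lemma mat_poly_add: "mat_poly (p + q) A = mat_poly p A + mat_poly q A"
proof (induction p arbitrary: q)
  case 0
  then show ?case by (simp add: mat_poly_0)
next
  case (pCons a p)
  obtain b r where q: "q = pCons b r" by (cases q)
  have "A * (mat_poly p A + mat_poly r A) = A * mat_poly p A + A * mat_poly r A"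
    by (rule mult_add_distrib_mat[OF A mat_poly_carrier mat_poly_carrier])
  moreover have "(x + y) \<cdot>\<^sub>m 1\<^sub>m n + (U + W) = (x \<cdot>\<^sub>m 1\<^sub>m n + U) + (y \<cdot>\<^sub>m 1\<^sub>m n + W)"
    if "U \<in> carrier_mat n n" "W \<in> carrier_mat n n" for x y :: 'a and U W
    by (rule eq_matI) (use that in \<open>auto simp: algebra_simps\<close>)
  ultimately show ?case
    using A by (simp add: q mat_poly_pCons pCons.IH of_rat_add mult_carrier_mat[of _ n n])
qed

lemma mat_poly_smult: "mat_poly (smult c p) A = of_rat c \<cdot>\<^sub>m mat_poly p A"
proof (induction p)
  case 0
  then show ?case by (simp add: mat_poly_0)
next
  case (pCons a p)
  have "A * (of_rat c \<cdot>\<^sub>m mat_poly p A) = of_rat c \<cdot>\<^sub>m (A * mat_poly p A)"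
    by (rule mult_smult_distrib[OF A mat_poly_carrier])
  moreover have "(x * y) \<cdot>\<^sub>m 1\<^sub>m n + x \<cdot>\<^sub>m U = x \<cdot>\<^sub>m (y \<cdot>\<^sub>m 1\<^sub>m n + U)"
    if "U \<in> carrier_mat n n" for x y :: 'a and U
    by (rule eq_matI) (use that in \<open>auto simp: algebra_simps\<close>)
  ultimately show ?case
    using A by (simp add: mat_poly_pCons pCons.IH of_rat_mult mult_carrier_mat[of _ n n])
qed

lemma mat_poly_diff: "mat_poly (p - q) A = mat_poly p A - mat_poly q A"
proof -
  have "mat_poly (p + smult (- 1) q) A = mat_poly p A + (- 1) \<cdot>\<^sub>m mat_poly q A"
    unfolding mat_poly_add mat_poly_smult by simp
  also have "\<dots> = mat_poly p A - mat_poly q A"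
    by (auto simp: minus_mat_def intro!: eq_matI)
  finally show ?thesis by simp
qed

lemma mat_poly_mult: "mat_poly (p * q) A = mat_poly p A * mat_poly q A"
proof (induction p)
  case 0
  then show ?case by (simp add: mat_poly_0 left_mult_zero_mat[OF mat_poly_carrier])
next
  case (pCons a p)
  have "mat_poly (pCons a p * q) A = of_rat a \<cdot>\<^sub>m mat_poly q A + A * mat_poly (p * q) A"
    using A by (simp add: mat_poly_add mat_poly_smult mat_poly_pCons) auto
  also have "\<dots> = (of_rat a \<cdot>\<^sub>m 1\<^sub>m n) * mat_poly q A + (A * mat_poly p A) * mat_poly q A"
    using A by (simp add: pCons.IH mult_smult_assoc_mat[of _ n n _ n] assoc_mult_mat[of _ n n _ n _ n])
  also have "\<dots> = mat_poly (pCons a p) A * mat_poly q A"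
    unfolding mat_poly_pCons using A by (intro add_mult_distrib_mat[symmetric]) auto
  finally show ?case .
qed

lemma mat_poly_power: "mat_poly (p ^ k) A = mat_poly p A ^\<^sub>m k"
  using A by (induction k) (simp_all add: mat_poly_1 mat_poly_mult power_Suc2 del: power_Suc)

lemma mat_poly_monom: "mat_poly (monom 1 k) A = A ^\<^sub>m k"
proof -
  have "mat_poly (monom 1 1) A = A"
    using A by (simp add: monom_Suc monom_0 mat_poly_pCons mat_poly_1) auto
  then show ?thesis
    using mat_poly_power[of "monom 1 1" k] by (simp add: monom_power)
qed

lemma mat_poly_dvd:
  assumes "p dvd q" and "mat_poly p A = 0\<^sub>m n n"
  shows "mat_poly q A = 0\<^sub>m n n"
  using assms by (auto simp: dvd_def mat_poly_mult left_mult_zero_mat[OF mat_poly_carrier])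

lemma mat_poly_sum_monom:
  assumes "finite I" and "i < n" and "j < n"
  shows "mat_poly (\<Sum>l\<in>I. smult (c l) (monom 1 l)) A $$ (i, j)
     = (\<Sum>l\<in>I. of_rat (c l) * (A ^\<^sub>m l) $$ (i, j))"
  using assms(1)
proof (induction I)
  case empty
  with assms show ?case by (simp add: mat_poly_0)
next
  case (insert l I)
  have "A ^\<^sub>m l \<in> carrier_mat n n" using A by simp
  moreover have "mat_poly (\<Sum>l\<in>I. smult (c l) (monom 1 l)) A \<in> carrier_mat n n" by simp
  ultimately show ?case
    using insert assms(2,3) A
    by (simp add: mat_poly_add mat_poly_smult mat_poly_monom del: smult_monom)
qed

end

lemma mat_poly_pcompose_monom:
  assumes A: "A \<in> carrier_mat n n"
  shows "mat_poly (p \<circ>\<^sub>p monom 1 m) A = mat_poly p (A ^\<^sub>m m)"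
proof (induction p)
  case 0
  show ?case using A by (simp add: mat_poly_0[of _ n])
next
  case (pCons a p)
  have "mat_poly [:a:] A = of_rat a \<cdot>\<^sub>m 1\<^sub>m n"
    using A by (auto simp: mat_poly_pCons[OF A] mat_poly_0[OF A])
  with pCons.IH show ?case
    using A by (simp add: pcompose_pCons mat_poly_add[OF A] mat_poly_mult[OF A]
        mat_poly_monom[OF A] mat_poly_pCons[of "A ^\<^sub>m m" n])
qed

section \<open>Minimal polynomials over the rational numbers\<close>

lemma sum_fun_apply: "(\<Sum>i\<in>I. f i) x = (\<Sum>i\<in>I. f i x)"
  by (induction I rule: infinite_finite_induct) auto

text \<open>
  Repeated vectors count as dependent here, which a statement about the set of vectors would miss;
  this matters because the powers of a matrix may repeat.
\<close>

lemma dependent_family_in_span: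
  fixes scale :: "'b::field \<Rightarrow> 'c::ab_group_add \<Rightarrow> 'c" and v :: "nat \<Rightarrow> 'c"
  assumes "vector_space scale" and "finite T"
    and span: "\<And>l. v l \<in> module.span scale T"
  shows "\<exists>c. (\<exists>l\<le>card T. c l \<noteq> 0) \<and> (\<Sum>l\<le>card T. scale (c l) (v l)) = 0"
proof -
  interpret vector_space scale by fact
  let ?I = "{..card T}"
  show ?thesis
  proof (cases "inj_on v ?I")
    case True
    have "card (v ` ?I) = Suc (card T)"
      using True by (simp add: card_image)
    then have "dependent (v ` ?I)"
      using independent_span_bound[of T "v ` ?I"] span \<open>finite T\<close> by force
    then obtain u where u: "\<exists>x\<in>v ` ?I. u x \<noteq> 0" "(\<Sum>x\<in>v ` ?I. scale (u x) x) = 0"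
      using dependent_finite[of "v ` ?I"] by auto
    then show ?thesis
      using True by (intro exI[of _ "\<lambda>l. u (v l)"]) (auto simp: sum.reindex)
  next
    case False
    then obtain k l where kl: "k \<in> ?I" "l \<in> ?I" "k \<noteq> l" "v k = v l"
      unfolding inj_on_def by blast
    define c where "c = (\<lambda>i. if i = k then 1 else if i = l then - 1 else 0 :: 'b)"
    have "(\<Sum>i\<le>card T. scale (c i) (v i)) = (\<Sum>i\<in>{k, l}. scale (c i) (v i))"
      using kl by (intro sum.mono_neutral_right) (auto simp: c_def)
    also have "\<dots> = 0"
      using kl by (simp add: c_def)
    finally show ?thesis
      using kl by (intro exI[of _ c]) (auto simp: c_def)
  qed
qed

text \<open>
  A matrix is encoded as a function on index pairs, so that matrices form a type that is a vector
  space over \<open>\<rat>\<close>. Those supported on \<open>{..<n} \<times> {..<n}\<close> are spanned by the matrices with a single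
  entry taken from a basis of the field; more powers of \<open>A\<close> than there are such matrices are linearly
  dependent.
\<close>

lemma rational_annihilator_of_bounded_degree:
  assumes "number_field TYPE('a::field_char_0)"
  shows "\<exists>N. \<forall>A \<in> carrier_mat n n. \<exists>p. p \<noteq> 0 \<and> degree p \<le> N \<and> mat_poly p (A :: 'a mat) = 0\<^sub>m n n"
proof -
  obtain B :: "'a set" where "finite_dimensional_vector_space (\<lambda>(q :: rat) (x :: 'a). of_rat q * x) B"
    using assms unfolding number_field_def by blast
  then interpret K: finite_dimensional_vector_space "\<lambda>(q :: rat) (x :: 'a). of_rat q * x" B .
  let ?scale = "\<lambda>(q :: rat) (f :: nat \<times> nat \<Rightarrow> 'a) x. of_rat q * f x"
  interpret V: vector_space ?scale
    by unfold_locales (auto simp: fun_eq_iff of_rat_add of_rat_mult algebra_simps)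
  define e where "e = (\<lambda>(ij :: nat \<times> nat) (x :: 'a) kl. if kl = ij then x else (0 :: 'a))"
  let ?I = "{..<n} \<times> {..<n}"
  define T where "T = (\<lambda>(ij, b). e ij b) ` (?I \<times> B)"
  define vec where "vec = (\<lambda>M ij. if ij \<in> ?I then M $$ ij else (0 :: 'a))"
  have "finite T"
    unfolding T_def using K.finite_Basis by simp
  have e_span: "e ij x \<in> V.span T" if "ij \<in> ?I" for ij x
  proof -
    have "x \<in> K.span B"
      by (simp add: K.span_Basis)
    then show ?thesis
    proof (induction rule: K.span_induct_alt)
      case base
      have "e ij 0 = 0" by (auto simp: e_def)
      then show ?case by (metis V.span_zero)
    next
      case (step q b y)
      have "e ij (of_rat q * b + y) = ?scale q (e ij b) + e ij y"
        by (auto simp: e_def)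
      moreover have "e ij b \<in> V.span T"
        using step(1) that by (intro V.span_base) (auto simp: T_def)
      ultimately show ?case
        using step(2) by (metis V.span_add V.span_scale)
    qed
  qed
  have "vec M = (\<Sum>ij\<in>?I. e ij (M $$ ij))" for M
    by (auto simp: vec_def e_def fun_eq_iff sum.delta' sum_fun_apply)
  then have span: "vec M \<in> V.span T" for M
    using e_span by (simp add: V.span_sum)
  have "\<exists>p. p \<noteq> 0 \<and> degree p \<le> card T \<and> mat_poly p A = 0\<^sub>m n n" if A: "A \<in> carrier_mat n n" for A :: "'a mat"
  proof -
    obtain c where c: "\<exists>l\<le>card T. c l \<noteq> 0"
        and sum0: "(\<Sum>l\<le>card T. ?scale (c l) (vec (A ^\<^sub>m l))) = 0"
      using dependent_family_in_span[OF V.vector_space_axioms \<open>finite T\<close>, of "\<lambda>l. vec (A ^\<^sub>m l)"] span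
      by blast
    define p where "p = (\<Sum>l\<le>card T. smult (c l) (monom 1 l))"
    have coeff_p: "coeff p l = (if l \<le> card T then c l else 0)" for l
      by (simp add: p_def coeff_sum if_distrib cong: if_cong)
    have "mat_poly p A $$ (i, j) = 0" if "i < n" "j < n" for i j
      using fun_cong[OF sum0, of "(i, j)"] that
      by (simp add: p_def mat_poly_sum_monom[OF A] vec_def sum_fun_apply)
    then have "mat_poly p A = 0\<^sub>m n n"
      using mat_poly_carrier[OF A, of p] by (intro eq_matI) auto
    moreover have "p \<noteq> 0"
      using c coeff_p by (metis coeff_0)
    moreover have "degree p \<le> card T"
      using coeff_p by (intro degree_le) auto
    ultimately show ?thesis by blast
  qed
  then show ?thesis by blast
qed

lemma minimal_polynomial_exists:
  assumes A: "A \<in> carrier_mat n n"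
    and p: "p \<noteq> 0" "degree p \<le> N" "mat_poly p A = 0\<^sub>m n n"
  shows "\<exists>q. monic q \<and> degree q \<le> N \<and> mat_poly q A = 0\<^sub>m n n \<and>
    (\<forall>r. mat_poly r A = 0\<^sub>m n n \<longrightarrow> q dvd r)"
proof -
  let ?P = "\<lambda>p. p \<noteq> 0 \<and> mat_poly p A = 0\<^sub>m n n"
  obtain q0 where q0: "?P q0" and least: "\<And>r. ?P r \<Longrightarrow> degree q0 \<le> degree r"
    using ex_has_least_nat[of ?P p degree] p by blast
  define q where "q = smult (inverse (lead_coeff q0)) q0"
  have monic: "monic q" and deg: "degree q = degree q0" and q: "mat_poly q A = 0\<^sub>m n n"
    using q0 by (auto simp: q_def mat_poly_smult[OF A])
  have "q dvd r" if r: "mat_poly r A = 0\<^sub>m n n" for r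
  proof (rule ccontr)
    assume "\<not> q dvd r"
    then have nz: "r mod q \<noteq> 0" by (simp add: mod_eq_0_iff_dvd)
    have "r mod q = r - q * (r div q)"
      by (simp add: minus_mult_div_eq_mod)
    then have "mat_poly (r mod q) A = 0\<^sub>m n n"
      using q r by (simp add: mat_poly_diff[OF A] mat_poly_mult[OF A] left_mult_zero_mat[OF mat_poly_carrier[OF A]])
    with nz have "degree q \<le> degree (r mod q)"
      using least deg by simp
    moreover have "degree (r mod q) < degree q"
      using degree_mod_less'[OF _ nz] monic by fastforce
    ultimately show False by simp
  qed
  with monic deg q least p show ?thesis
    by (metis order_trans)
qed

lemma minimal_polynomial_of_bounded_degree:
  assumes "number_field TYPE('a::field_char_0)"
  shows "\<exists>N. \<forall>A \<in> carrier_mat n n. \<exists>q. monic q \<and> degree q \<le> N \<and>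
    mat_poly q (A :: 'a mat) = 0\<^sub>m n n \<and> (\<forall>r. mat_poly r A = 0\<^sub>m n n \<longrightarrow> q dvd r)"
  using rational_annihilator_of_bounded_degree[OF assms, of n] minimal_polynomial_exists
  by meson

text \<open>
  If the constant term vanished, cancelling \<open>A\<close> would remove a factor \<open>x\<close> from the minimal polynomial
  and leave an annihilating polynomial of smaller degree.
\<close>

lemma minimal_polynomial_nonzero_at_0:
  assumes A: "A \<in> carrier_mat n n"
    and cancel: "\<And>M. M \<in> carrier_mat n n \<Longrightarrow> A * M = 0\<^sub>m n n \<Longrightarrow> M = 0\<^sub>m n n"
    and q: "q \<noteq> 0" "mat_poly q A = 0\<^sub>m n n" "\<And>r. mat_poly r A = 0\<^sub>m n n \<Longrightarrow> q dvd r"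
  shows "poly q 0 \<noteq> 0"
proof
  assume "poly q 0 = 0"
  then obtain s where s: "q = pCons 0 s"
    by (cases q) auto
  have "A * mat_poly s A = 0\<^sub>m n n"
  proof -
    have "A * mat_poly s A \<in> carrier_mat n n"
      using A mat_poly_carrier[OF A] by (rule mult_carrier_mat)
    then have "A * mat_poly s A = of_rat 0 \<cdot>\<^sub>m 1\<^sub>m n + A * mat_poly s A"
      using A by (intro eq_matI) auto
    with q(2) show ?thesis
      unfolding s mat_poly_pCons[OF A] by simp
  qed
  then have "q dvd s"
    using cancel q(3) mat_poly_carrier[OF A] by blast
  moreover have "s \<noteq> 0" using q(1) s by auto
  ultimately have "degree q \<le> degree s" by (rule dvd_imp_degree_le)
  with \<open>s \<noteq> 0\<close> show False by (simp add: s)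
qed

section \<open>Divisible matrices\<close>

text \<open>
  The inverse that membership in \<open>G\<close> provides has entries in the algebraic closure; it suffices for
  cancelling \<open>g\<close> from products over the base field, because the embedding is injective.
\<close>

lemma rational_points_carrier_and_cancel:
  assumes G: "linear_algebraic_group n G" and g: "g \<in> rational_points G"
  shows "g \<in> carrier_mat n n"
    and "M \<in> carrier_mat n n \<Longrightarrow> g * M = 0\<^sub>m n n \<Longrightarrow> M = 0\<^sub>m n n"
proof -
  interpret to_ac: field_hom "to_ac :: 'a \<Rightarrow> 'a alg_closure"
    by unfold_locales simp_all
  let ?g = "map_mat to_ac g"
  have "?g \<in> carrier (GL n)"
    using G g unfolding linear_algebraic_group_def rational_points_def by auto
  then obtain h where g': "?g \<in> carrier_mat n n" and h: "h \<in> carrier_mat n n" "h * ?g = 1\<^sub>m n"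
    unfolding GL_def units_of_carrier Units_def by (auto simp: ring_mat_simps)
  then show carrier: "g \<in> carrier_mat n n" by simp
  assume M: "M \<in> carrier_mat n n" and gM: "g * M = 0\<^sub>m n n"
  let ?M = "map_mat to_ac M"
  have M': "?M \<in> carrier_mat n n" using M by simp
  have zero: "map_mat to_ac (0\<^sub>m n n) = (0\<^sub>m n n :: 'a alg_closure mat)"
    by (intro eq_matI) auto
  then have "?g * ?M = 0\<^sub>m n n"
    using to_ac.mat_hom_mult[OF carrier M] gM by simp
  then have "0\<^sub>m n n = h * (?g * ?M)"
    using h(1) by simp
  also have "\<dots> = ?M"
    using assoc_mult_mat[OF h(1) g' M'] h(2) M' by simp
  finally show "M = 0\<^sub>m n n"
    using zero to_ac.mat_hom_inj by metis
qed

text \<open>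
  For each \<open>m\<close> in \<open>S\<close>, the minimal polynomial of an \<open>m\<close>-th root of \<open>g\<close> has bounded degree and divides
  \<open>f(x\<^sup>m)\<close>. Only finitely many polynomials do, so one of them occurs for infinitely many \<open>m\<close>; all its
  roots are then roots of unity.
\<close>

lemma minimal_polynomial_of_divisible_matrix:
  fixes g :: "'a::field_char_0 mat"
  assumes K: "number_field TYPE('a)" and g: "g \<in> carrier_mat n n"
    and f: "monic f" "mat_poly f g = 0\<^sub>m n n" "\<And>t. mat_poly t g = 0\<^sub>m n n \<Longrightarrow> f dvd t"
    and f0: "poly f 0 \<noteq> 0"
    and exps: "infinite S" "0 \<notin> S"
    and roots: "\<And>m. m \<in> S \<Longrightarrow> \<exists>h\<in>carrier_mat n n. h ^\<^sub>m m = g"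
  shows "\<exists>s\<ge>1. \<exists>e. f dvd (monom 1 s - 1) ^ e"
proof -
  obtain N where N: "\<And>A :: 'a mat. A \<in> carrier_mat n n \<Longrightarrow>
      \<exists>q. monic q \<and> degree q \<le> N \<and> mat_poly q A = 0\<^sub>m n n \<and> (\<forall>r. mat_poly r A = 0\<^sub>m n n \<longrightarrow> q dvd r)"
    using minimal_polynomial_of_bounded_degree[OF K] by blast
  obtain h where h: "\<And>m. m \<in> S \<Longrightarrow> h m \<in> carrier_mat n n" "\<And>m. m \<in> S \<Longrightarrow> h m ^\<^sub>m m = g"
    using roots by metis
  have "\<exists>q. monic q \<and> degree q \<le> N \<and> mat_poly q (h m) = 0\<^sub>m n n \<and> q dvd f \<circ>\<^sub>p monom 1 m"
    if m: "m \<in> S" for m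
  proof -
    have "mat_poly (f \<circ>\<^sub>p monom 1 m) (h m) = 0\<^sub>m n n"
      using f(2) by (simp add: mat_poly_pcompose_monom[OF h(1)[OF m]] h(2)[OF m])
    with N[OF h(1)[OF m]] show ?thesis by blast
  qed
  then obtain q where q: "\<And>m. m \<in> S \<Longrightarrow> monic (q m) \<and> degree (q m) \<le> N \<and>
      mat_poly (q m) (h m) = 0\<^sub>m n n \<and> q m dvd f \<circ>\<^sub>p monom 1 m"
    by metis
  have "q ` S \<subseteq> {q. monic q \<and> degree q \<le> N \<and> (\<exists>m\<ge>1. q dvd f \<circ>\<^sub>p monom 1 m)}"
  proof
    fix t assume "t \<in> q ` S"
    then obtain m where m: "m \<in> S" "t = q m"
      by blast
    moreover have "m \<ge> 1"
      using m(1) exps(2) by (cases m) auto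
    ultimately show "t \<in> {q. monic q \<and> degree q \<le> N \<and> (\<exists>m\<ge>1. q dvd f \<circ>\<^sub>p monom 1 m)}"
      using q by blast
  qed
  moreover have "f \<noteq> 0" using f(1) by auto
  ultimately have "finite (q ` S)"
    using finite_divisors_of_power_substitutions finite_subset by blast
  then obtain k where k: "k \<in> S" and inf: "infinite {m \<in> S. q m = q k}"
    using pigeonhole_infinite[OF exps(1)] by blast
  have "{m \<in> S. q m = q k} \<subseteq> {m. q k dvd f \<circ>\<^sub>p monom 1 m}"
  proof clarify
    fix m assume "m \<in> S" "q m = q k"
    then show "q k dvd f \<circ>\<^sub>p monom 1 m"
      using q[of m] by simp
  qed
  with inf have "infinite {m. q k dvd f \<circ>\<^sub>p monom 1 m}"
    using infinite_super by blast
  then obtain s where s: "s \<ge> 1" "q k dvd (monom 1 s - 1) ^ degree (q k)"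
    using roots_of_unity_of_infinitely_many_power_substitutions[OF _ f0] q[OF k] by blast
  let ?e = "degree (q k)"
  \<comment> \<open>Back from the root \<open>h k\<close> to \<open>g\<close>: since \<open>g = (h k)\<^sup>k\<close>, evaluating \<open>(x\<^sup>s - 1)\<^sup>e\<close> at \<open>g\<close> is evaluating
    \<open>(x\<^sup>s\<^sup>k - 1)\<^sup>e\<close>, a multiple of \<open>(x\<^sup>s - 1)\<^sup>e\<close>, at \<open>h k\<close>.\<close>
  have "(monom 1 s - 1 :: rat poly) dvd monom 1 (s * k) - 1"
    using power_diff_1_eq[of "monom 1 s :: rat poly" k] by (simp add: monom_power)
  then have "q k dvd (monom 1 (s * k) - 1) ^ ?e"
    using s(2) dvd_power_same dvd_trans by blast
  then have "mat_poly ((monom 1 (s * k) - 1) ^ ?e) (h k) = 0\<^sub>m n n"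
    using mat_poly_dvd[OF h(1)[OF k]] q[OF k] by blast
  then have "mat_poly ((monom 1 s - 1) ^ ?e) g = 0\<^sub>m n n"
    using mat_poly_pcompose_monom[OF h(1)[OF k], of "(monom 1 s - 1) ^ ?e" k]
    by (simp add: pcompose_monom_minus_1_power h(2)[OF k])
  with f(3) s(1) show ?thesis by blast
qed

text \<open>
  The exponent \<open>r\<close> depends only on \<open>n\<close> and the field: it serves all monic rational polynomials of
  degree at most \<open>N\<close> whose roots are roots of unity.
\<close>

lemma divisible_matrices_uniformly_quasi_unipotent:
  assumes K: "number_field TYPE('a::field_char_0)"
  shows "\<exists>r\<ge>1. \<forall>g \<in> carrier_mat n n.
    (\<forall>M \<in> carrier_mat n n. g * M = 0\<^sub>m n n \<longrightarrow> M = 0\<^sub>m n n) \<longrightarrow>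
    infinite {m. \<exists>h\<in>carrier_mat n n. h ^\<^sub>m m = g} \<longrightarrow>
    unipotent (g ^\<^sub>m r :: 'a mat)"
proof -
  obtain N where N: "\<And>A :: 'a mat. A \<in> carrier_mat n n \<Longrightarrow>
      \<exists>q. monic q \<and> degree q \<le> N \<and> mat_poly q A = 0\<^sub>m n n \<and> (\<forall>r. mat_poly r A = 0\<^sub>m n n \<longrightarrow> q dvd r)"
    using minimal_polynomial_of_bounded_degree[OF K] by blast
  obtain r where r: "r \<ge> 1" "\<And>q :: rat poly. monic q \<Longrightarrow> degree q \<le> N \<Longrightarrow>
      \<exists>s\<ge>1. \<exists>e. q dvd (monom 1 s - 1) ^ e \<Longrightarrow> q dvd (monom 1 r - 1) ^ N"
    using uniform_exponent_of_roots_of_unity by meson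
  have "unipotent (g ^\<^sub>m r)"
    if g: "g \<in> carrier_mat n n"
      and cancel: "\<forall>M \<in> carrier_mat n n. g * M = 0\<^sub>m n n \<longrightarrow> M = 0\<^sub>m n n"
      and inf: "infinite {m. \<exists>h\<in>carrier_mat n n. h ^\<^sub>m m = g}" for g :: "'a mat"
  proof -
    let ?S = "{m. \<exists>h\<in>carrier_mat n n. h ^\<^sub>m m = g} - {0}"
    obtain f where f: "monic f" "degree f \<le> N" "mat_poly f g = 0\<^sub>m n n"
        "\<And>t. mat_poly t g = 0\<^sub>m n n \<Longrightarrow> f dvd t"
      using N[OF g] by blast
    have "poly f 0 \<noteq> 0"
      using f cancel by (intro minimal_polynomial_nonzero_at_0[OF g]) auto
    moreover have "infinite ?S" "0 \<notin> ?S"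
      using inf by auto
    ultimately have "\<exists>s\<ge>1. \<exists>e. f dvd (monom 1 s - 1) ^ e"
      using minimal_polynomial_of_divisible_matrix[OF K g f(1,3,4), of ?S] by blast
    with f have "f dvd (monom 1 r - 1) ^ N"
      by (intro r(2))
    with f(3) have "mat_poly ((monom 1 r - 1) ^ N) g = 0\<^sub>m n n"
      using mat_poly_dvd[OF g] by blast
    then have "(g ^\<^sub>m r - 1\<^sub>m n) ^\<^sub>m N = 0\<^sub>m n n"
      by (simp add: mat_poly_power[OF g] mat_poly_diff[OF g] mat_poly_monom[OF g] mat_poly_1[OF g])
    moreover have "dim_row (g ^\<^sub>m r) = n" "dim_col (g ^\<^sub>m r) = n"
      using g by auto
    ultimately show ?thesis
      unfolding unipotent_def by auto
  qed
  with r(1) show ?thesis by blast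
qed

theorem corollary4p1:
  fixes n :: nat and G :: "('a::field_char_0) alg_closure mat set"
  assumes "number_field TYPE('a)"
    and "linear_algebraic_group n G"
  shows "(\<forall>(p::nat) E. prime p \<longrightarrow> E \<subseteq> rational_points G \<longrightarrow>
            (\<forall>g\<in>E. \<forall>k::nat. \<exists>h\<in>rational_points G. h ^\<^sub>m (p ^ k) = g) \<longrightarrow>
            (\<exists>r::nat. r \<ge> 1 \<and> (\<forall>g\<in>E. unipotent (g ^\<^sub>m r)))) \<and>
         ((\<forall>k::nat. k \<ge> 1 \<longrightarrow> power_map k ` rational_points G = rational_points G) \<longrightarrow>
            (\<forall>g\<in>rational_points G. unipotent g))"
proof -
  note carrier = rational_points_carrier_and_cancel(1)[OF assms(2)]
  note cancel = rational_points_carrier_and_cancel(2)[OF assms(2)]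
  obtain r where r: "r \<ge> 1" and quasi: "\<And>g :: 'a mat. g \<in> carrier_mat n n \<Longrightarrow>
      (\<forall>M \<in> carrier_mat n n. g * M = 0\<^sub>m n n \<longrightarrow> M = 0\<^sub>m n n) \<Longrightarrow>
      infinite {m. \<exists>h\<in>carrier_mat n n. h ^\<^sub>m m = g} \<Longrightarrow> unipotent (g ^\<^sub>m r)"
    using divisible_matrices_uniformly_quasi_unipotent[OF assms(1)] by blast
  have unip: "unipotent (g ^\<^sub>m r)"
    if g: "g \<in> rational_points G" and p: "p \<ge> 2"
      and roots: "\<And>k. \<exists>h\<in>rational_points G. h ^\<^sub>m (p ^ k) = g" for g and p :: nat
  proof (rule quasi)
    have "range (\<lambda>k. p ^ k) \<subseteq> {m. \<exists>h\<in>carrier_mat n n. h ^\<^sub>m m = g}"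
      using roots carrier by blast
    moreover have "infinite (range (\<lambda>k. p ^ k))"
      using p by (intro range_inj_infinite injI) (simp add: power_inject_exp)
    ultimately show "infinite {m. \<exists>h\<in>carrier_mat n n. h ^\<^sub>m m = g}"
      using infinite_super by blast
  qed (use g carrier cancel in auto)
  show ?thesis
  proof (intro conjI allI impI ballI)
    fix p :: nat and E
    assume "prime p" "E \<subseteq> rational_points G"
      "\<forall>g\<in>E. \<forall>k. \<exists>h\<in>rational_points G. h ^\<^sub>m (p ^ k) = g"
    then have "\<forall>g\<in>E. unipotent (g ^\<^sub>m r)"
      using unip prime_ge_2_nat by blast
    with r show "\<exists>r\<ge>1. \<forall>g\<in>E. unipotent (g ^\<^sub>m r)" by blast
  next
    fix g
    assume surj: "\<forall>k\<ge>1. power_map k ` rational_points G = rational_points G"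
      and g: "g \<in> rational_points G"
    have root: "\<exists>h\<in>rational_points G. h ^\<^sub>m k = g" if "k \<ge> 1" "g \<in> rational_points G" for g k
    proof -
      have "g \<in> power_map k ` rational_points G"
        using surj that by blast
      then show ?thesis by (auto simp: power_map_def)
    qed
    \<comment> \<open>The exponent \<open>r\<close> is absorbed by taking an \<open>r\<close>-th root \<open>h\<close> of \<open>g\<close>, which is again divisible.\<close>
    obtain h where h: "h \<in> rational_points G" "h ^\<^sub>m r = g"
      using root[OF r g] by blast
    have "unipotent (h ^\<^sub>m r)"
    proof (rule unip[OF h(1) order_refl])
      show "\<exists>x\<in>rational_points G. x ^\<^sub>m (2 ^ k) = h" for k :: nat
        by (rule root[OF _ h(1)]) simp
    qed
    with h(2) show "unipotent g" by simp
  qed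
qed

end
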